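(* Let $\mathcal B_1,\mathcal B_2$ be countable sets with distinguished subsets $\mathbf{ex}_i\subseteq\mathcal B_i$ ($i=1,2$) and let $\phi\colon\mathcal B_1^0\to\mathcal B_2^0$ be $\mathbf{ex}$-admissible. Then $\phi$ induces a natural transformation $\phi\colon\mu_{\mathcal B_1}\to\mu_{\mathcal B_2}\circ\mathbf F$ of functors $\mathcal E(\mathbf{ex}_1,\mathcal B_1)\to\mathbf{Set}$, with component at $\underline k$ the function $\phi_{\underline k}\colon\mu_{\underline k}(\mathcal B_1)^0\to\mu_{F\underline k}(\mathcal B_2)^0$.
   Context: For a set $\mathcal B$ with $\mathbf{ex}\subseteq\mathcal B$ and $k\in\mathbf{ex}$, let $\mu_{\mathcal B}(k)$ be a new element not in $\mathcal B$, and put $\mu_k(\mathcal B)=(\mathcal B\setminus\{k\})\cup\{\mu_{\mathcal B}(k)\}$, $\mu_k(\mathbf{ex})=(\mathbf{ex}\setminus\{k\})\cup\{\mu_{\mathcal B}(k)\}$. There is a bijection $\mu_k\colon\mathcal B\to\mu_k(\mathcal B)$ fixing $b\ne k$ and sending $k$ to $\mu_{\mathcal B}(k)$. Iterating, $\mathcal K(\mathbf{ex},\mathcal B)$ is the set of $(\mathbf{ex},\mathcal B)$-admissible sequences: tuples $\underline k=(k_r,\dots,k_1)$, including $()$, with $k_i\in\mu_{k_{i-1}}(\cdots(\mu_{k_1}(\mathbf{ex})))$ for all $i$; $\mu_{\underline k}(\mathcal B)=\mu_{k_r}(\cdots\mu_{k_1}(\mathcal B))$, similarly $\mu_{\underline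 k}(\mathbf{ex})$; and $\mu_{\underline k}\colon\mathcal B\to\mu_{\underline k}(\mathcal B)$ is the composite bijection. For a set $S$ not containing the symbol $0$, $S^0=S\sqcup\{0\}$; a superscript $0$ on a bijection denotes its extension by $0\mapsto0$. For $k\in\mu_{\underline k}(\mathbf{ex})$, $\mu^0_{k,\underline k}\colon\mu_{\underline k}(\mathcal B)^0\to\mu_{(k,\underline k)}(\mathcal B)^0$ is the (extended) one-step bijection. The directed exchange tree $E(\mathbf{ex},\mathcal B)$ has vertex set $\mathcal K(\mathbf{ex},\mathcal B)$ and an arrow $\vec\mu_k\colon\underline k\to(k,\underline k)$ for each $k\in\mu_{\underline k}(\mathbf{ex})$; $\mathcal E(\mathbf{ex},\mathcal B)$ is its (ordinary) path category. The functor $\mu_{\mathcal B}\colon\mathcal E(\mathbf{ex},\mathcal B)\to\mathbf{Set}$ is $\mu_{\mathcal B}(\underline k)=\mu_{\underline k}(\mathcal B)^0$, $\mu_{\mathcal B}(\vec\mu_k\colon\underline k\to(k,\underline k))=\mu^0_{k,\underline k}$. $\phi\colon\mathcal B_1^0\to\mathcal B_2^0$ is $\mathbf{ex}$-admissible if $\phi(0)=0$ and $\phi(\mathbf{ex}_1)\subseteq\mathbf{ex}_2^0$. Given such $\phi$, define for $\underline k\in\mathcal K(\mathbf{ex}_1,\mathcal B_1)$, recursively on the length $r$: $F()=()$, $\phi_{()}=\phi$; for $r\ge1$ and $\underline k'=(k_{r-1},\dots,k_1)$, $F\underline k=(\phi_{\underline k'}(k_r),F\underline k')$ if $\phi_{\underline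 k'}(k_r)\in\mu_{F\underline k'}(\mathbf{ex}_2)$ and $F\underline k=F\underline k'$ if $\phi_{\underline k'}(k_r)=0$; and $\phi_{\underline k}=\mu^0_{F\underline k}\circ\phi\circ(\mu^0_{\underline k})^{-1}$. (One has $F\underline k\in\mathcal K(\mathbf{ex}_2,\mathcal B_2)$ and $\phi_{\underline k}(\mu_{\underline k}(\mathbf{ex}_1))\subseteq\mu_{F\underline k}(\mathbf{ex}_2)^0$.) The functor $\mathbf F\colon\mathcal E(\mathbf{ex}_1,\mathcal B_1)\to\mathcal E(\mathbf{ex}_2,\mathcal B_2)$ is $\mathbf F\underline k=F\underline k$ on objects and sends $\vec\mu_k\colon\underline k\to(k,\underline k)$ to $\vec\mu_{\phi_{\underline k}(k)}$ if $\phi_{\underline k}(k)\ne0$ and to $\mathrm{id}_{F\underline k}$ if $\phi_{\underline k}(k)=0$. *)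

theory Defs
  imports "HOL-Library.FuncSet" "HOL-Library.Countable_Set"
    "Graph_Theory.Digraph" "Graph_Theory.Arc_Walk"
begin

section \<open>Categories, functors, natural transformations\<close>

record ('o, 'm) cat =
  Obj :: "'o set"
  Arr :: "'m set"
  Src :: "'m \<Rightarrow> 'o"
  Tgt :: "'m \<Rightarrow> 'o"
  Idt :: "'o \<Rightarrow> 'm"
  Cmp :: "'m \<Rightarrow> 'm \<Rightarrow> 'm"  \<comment> \<open>\<open>Cmp C g f\<close> is g after f\<close>

definition Hom :: "('o, 'm) cat \<Rightarrow> 'o \<Rightarrow> 'o \<Rightarrow> 'm set" where
  "Hom C x y = {f \<in> Arr C. Src C f = x \<and> Tgt C f = y}"

locale category =
  fixes C :: "('o, 'm) cat"
  assumes Src_Obj: "f \<in> Arr C \<Longrightarrow> Src C f \<in> Obj C"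
    and Tgt_Obj: "f \<in> Arr C \<Longrightarrow> Tgt C f \<in> Obj C"
    and Idt_Hom: "x \<in> Obj C \<Longrightarrow> Idt C x \<in> Hom C x x"
    and Cmp_Hom: "f \<in> Hom C x y \<Longrightarrow> g \<in> Hom C y z \<Longrightarrow> Cmp C g f \<in> Hom C x z"
    and Cmp_Idt: "f \<in> Hom C x y \<Longrightarrow> Cmp C f (Idt C x) = f"
    and Idt_Cmp: "f \<in> Hom C x y \<Longrightarrow> Cmp C (Idt C y) f = f"
    and Cmp_assoc: "f \<in> Hom C w x \<Longrightarrow> g \<in> Hom C x y \<Longrightarrow> h \<in> Hom C y z \<Longrightarrow>
      Cmp C h (Cmp C g f) = Cmp C (Cmp C h g) f"

record ('o1, 'm1, 'o2, 'm2) fnctr =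
  FObj :: "'o1 \<Rightarrow> 'o2"
  FArr :: "'m1 \<Rightarrow> 'm2"

locale cat_functor = dom_cat: category C + cod_cat: category D
  for C :: "('o1, 'm1) cat" and D :: "('o2, 'm2) cat" +
  fixes F :: "('o1, 'm1, 'o2, 'm2) fnctr"
  assumes FObj_Obj: "x \<in> Obj C \<Longrightarrow> FObj F x \<in> Obj D"
    and FArr_Hom: "f \<in> Hom C x y \<Longrightarrow> FArr F f \<in> Hom D (FObj F x) (FObj F y)"
    and FArr_Idt: "x \<in> Obj C \<Longrightarrow> FArr F (Idt C x) = Idt D (FObj F x)"
    and FArr_Cmp: "f \<in> Hom C x y \<Longrightarrow> g \<in> Hom C y z \<Longrightarrow>
      FArr F (Cmp C g f) = Cmp D (FArr F g) (FArr F f)"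

definition functor_comp ::
  "('o2, 'm2, 'o3, 'm3) fnctr \<Rightarrow> ('o1, 'm1, 'o2, 'm2) fnctr \<Rightarrow> ('o1, 'm1, 'o3, 'm3) fnctr" where
  "functor_comp G F = \<lparr>FObj = FObj G \<circ> FObj F, FArr = FArr G \<circ> FArr F\<rparr>"

locale natural_transformation = F: cat_functor C D F + G: cat_functor C D G
  for C :: "('o1, 'm1) cat" and D :: "('o2, 'm2) cat"
    and F G :: "('o1, 'm1, 'o2, 'm2) fnctr" +
  fixes \<eta> :: "'o1 \<Rightarrow> 'm2"
  assumes component: "x \<in> Obj C \<Longrightarrow> \<eta> x \<in> Hom D (FObj F x) (FObj G x)"
    and naturality: "f \<in> Hom C x y \<Longrightarrow> Cmp D (\<eta> y) (FArr F f) = Cmp D (FArr G f) (\<eta> x)"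

text \<open>The category of all sets of elements of a type. A morphism is a function together with its
  domain and codomain; it is undefined outside its domain, so that equality of morphisms is
  equality of functions on the domain.\<close>

definition set_cat :: "('a set, 'a set \<times> ('a \<Rightarrow> 'a) \<times> 'a set) cat" where
  "set_cat = \<lparr>
     Obj = UNIV,
     Arr = {(A, f, B). f \<in> A \<rightarrow>\<^sub>E B},
     Src = (\<lambda>(A, f, B). A),
     Tgt = (\<lambda>(A, f, B). B),
     Idt = (\<lambda>A. (A, (\<lambda>x\<in>A. x), A)),
     Cmp = (\<lambda>(B', g, C) (A, f, B). (A, compose A g f, C))\<rparr>"

text \<open>Arrows of the path category are triples of start vertex, list of arcs in order of
  traversal, and end vertex.\<close>

definition path_cat :: "('v, 'e) pre_digraph \<Rightarrow> ('v, 'v \<times> 'e list \<times> 'v) cat" where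
  "path_cat G = \<lparr>
     Obj = verts G,
     Arr = {(u, p, v). pre_digraph.awalk G u p v},
     Src = (\<lambda>(u, p, v). u),
     Tgt = (\<lambda>(u, p, v). v),
     Idt = (\<lambda>u. (u, [], u)),
     Cmp = (\<lambda>(v', q, w) (u, p, v). (u, p @ q, w))\<rparr>"

text \<open>The functor out of a path category determined by its values on vertices and on arcs.\<close>

primrec path_value ::
  "('v, 'e) pre_digraph \<Rightarrow> ('o, 'm) cat \<Rightarrow> ('v \<Rightarrow> 'o) \<Rightarrow> ('e \<Rightarrow> 'm) \<Rightarrow> 'v \<Rightarrow> 'e list \<Rightarrow> 'm" where
  "path_value G D fo fa u [] = Idt D (fo u)"
| "path_value G D fo fa u (e # p) = Cmp D (path_value G D fo fa (head G e) p) (fa e)"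

definition path_functor ::
  "('v, 'e) pre_digraph \<Rightarrow> ('o, 'm) cat \<Rightarrow> ('v \<Rightarrow> 'o) \<Rightarrow> ('e \<Rightarrow> 'm) \<Rightarrow>
    ('v, 'v \<times> 'e list \<times> 'v, 'o, 'm) fnctr" where
  "path_functor G D fo fa = \<lparr>FObj = fo, FArr = (\<lambda>(u, p, v). path_value G D fo fa u p)\<rparr>"

section \<open>Mutations of sets\<close>

text \<open>All sets in play are sets of elements of one type. The operation \<open>\<nu>\<close> is a choice
  of new elements: \<open>\<nu> B k\<close> is the element replacing k when B is mutated at k (see
  \<open>new_elements\<close> below). Lists carry the most recent mutation at the head, i.e. they have
  the form \<open>[k\<^sub>r, \<dots>, k\<^sub>1]\<close>.\<close>

primrec mut_set :: "('a set \<Rightarrow> 'a \<Rightarrow> 'a) \<Rightarrow> 'a set \<Rightarrow> 'a list \<Rightarrow> 'a set" where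
  "mut_set \<nu> B [] = B"
| "mut_set \<nu> B (k # ks) = (mut_set \<nu> B ks - {k}) \<union> {\<nu> (mut_set \<nu> B ks) k}"

primrec mut_ex :: "('a set \<Rightarrow> 'a \<Rightarrow> 'a) \<Rightarrow> 'a set \<Rightarrow> 'a set \<Rightarrow> 'a list \<Rightarrow> 'a set" where
  "mut_ex \<nu> ex B [] = ex"
| "mut_ex \<nu> ex B (k # ks) = (mut_ex \<nu> ex B ks - {k}) \<union> {\<nu> (mut_set \<nu> B ks) k}"

inductive_set adm_seqs :: "('a set \<Rightarrow> 'a \<Rightarrow> 'a) \<Rightarrow> 'a set \<Rightarrow> 'a set \<Rightarrow> 'a list set"
  for \<nu> :: "'a set \<Rightarrow> 'a \<Rightarrow> 'a" and ex B :: "'a set" where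
  Nil: "[] \<in> adm_seqs \<nu> ex B"
| Cons: "ks \<in> adm_seqs \<nu> ex B \<Longrightarrow> k \<in> mut_ex \<nu> ex B ks \<Longrightarrow> k # ks \<in> adm_seqs \<nu> ex B"

text \<open>Newness is required only of those sets that are reached from B by mutations.\<close>

definition new_elements :: "('a set \<Rightarrow> 'a \<Rightarrow> 'a) \<Rightarrow> 'a set \<Rightarrow> 'a set \<Rightarrow> bool" where
  "new_elements \<nu> ex B \<longleftrightarrow>
     (\<forall>ks \<in> adm_seqs \<nu> ex B. \<forall>k \<in> mut_ex \<nu> ex B ks. \<nu> (mut_set \<nu> B ks) k \<notin> mut_set \<nu> B ks)"

text \<open>Over an uncountable type, one choice works for all countable sets at once; any type embeds
  into such a type.\<close>

lemma countable_mut_set: "countable B \<Longrightarrow> countable (mut_set \<nu> B ks)"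
  by (induction ks) auto

lemma ex_new_elements:
  assumes "uncountable (UNIV :: 'a set)"
  shows "\<exists>\<nu> :: 'a set \<Rightarrow> 'a \<Rightarrow> 'a. \<forall>ex B. countable B \<longrightarrow> new_elements \<nu> ex B"
proof -
  have "\<exists>x. x \<notin> B" if "countable B" for B :: "'a set"
    using assms that by (metis UNIV_eq_I)
  then have "(SOME x. x \<notin> B) \<notin> B" if "countable B" for B :: "'a set"
    using that by (metis someI_ex)
  then have "\<forall>ex B. countable B \<longrightarrow> new_elements (\<lambda>B (k::'a). SOME x. x \<notin> B) ex B"
    unfolding new_elements_def using countable_mut_set by blast
  then show ?thesis by blast
qed

definition mut_step :: "('a set \<Rightarrow> 'a \<Rightarrow> 'a) \<Rightarrow> 'a set \<Rightarrow> 'a \<Rightarrow> 'a \<Rightarrow> 'a" where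
  "mut_step \<nu> B k b = (if b = k then \<nu> B k else b)"

primrec mut_map :: "('a set \<Rightarrow> 'a \<Rightarrow> 'a) \<Rightarrow> 'a set \<Rightarrow> 'a list \<Rightarrow> 'a \<Rightarrow> 'a" where
  "mut_map \<nu> B [] = id"
| "mut_map \<nu> B (k # ks) = mut_step \<nu> (mut_set \<nu> B ks) k \<circ> mut_map \<nu> B ks"

text \<open>The symbol 0 is \<open>None\<close>; a superscript 0 on a map is \<open>map_option\<close>.\<close>

definition zero_ext :: "'a set \<Rightarrow> 'a option set" where
  "zero_ext S = insert None (Some ` S)"

section \<open>The exchange tree and the mutation functor\<close>

text \<open>The arc from ks to k # ks is the pair of ks and k.\<close>

definition exchange_tree ::
  "('a set \<Rightarrow> 'a \<Rightarrow> 'a) \<Rightarrow> 'a set \<Rightarrow> 'a set \<Rightarrow> ('a list, 'a list \<times> 'a) pre_digraph" where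
  "exchange_tree \<nu> ex B = \<lparr>
     verts = adm_seqs \<nu> ex B,
     arcs = {(ks, k). ks \<in> adm_seqs \<nu> ex B \<and> k \<in> mut_ex \<nu> ex B ks},
     tail = (\<lambda>(ks, k). ks),
     head = (\<lambda>(ks, k). k # ks)\<rparr>"

abbreviation exchange_cat where
  "exchange_cat \<nu> ex B \<equiv> path_cat (exchange_tree \<nu> ex B)"

definition mut_functor where
  "mut_functor \<nu> ex B = path_functor (exchange_tree \<nu> ex B) set_cat
     (\<lambda>ks. zero_ext (mut_set \<nu> B ks))
     (\<lambda>(ks, k). (zero_ext (mut_set \<nu> B ks),
                 restrict (map_option (mut_step \<nu> (mut_set \<nu> B ks) k)) (zero_ext (mut_set \<nu> B ks)),
                 zero_ext (mut_set \<nu> B (k # ks))))"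

section \<open>Admissible maps\<close>

definition ex_admissible ::
  "'a set \<Rightarrow> 'a set \<Rightarrow> 'a set \<Rightarrow> 'a set \<Rightarrow> ('a option \<Rightarrow> 'a option) \<Rightarrow> bool" where
  "ex_admissible ex\<^sub>1 B\<^sub>1 ex\<^sub>2 B\<^sub>2 \<phi> \<longleftrightarrow>
     \<phi> \<in> zero_ext B\<^sub>1 \<rightarrow> zero_ext B\<^sub>2 \<and> \<phi> None = None \<and> \<phi> ` Some ` ex\<^sub>1 \<subseteq> zero_ext ex\<^sub>2"

text \<open>\<open>transport \<nu> B\<^sub>1 B\<^sub>2 \<phi> ks ls\<close> is \<open>\<phi>\<close> conjugated by the mutation bijections
  along ks on the source and along ls on the target.\<close>

definition transport ::
  "('a set \<Rightarrow> 'a \<Rightarrow> 'a) \<Rightarrow> 'a set \<Rightarrow> 'a set \<Rightarrow> ('a option \<Rightarrow> 'a option) \<Rightarrow>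
    'a list \<Rightarrow> 'a list \<Rightarrow> 'a option \<Rightarrow> 'a option" where
  "transport \<nu> B\<^sub>1 B\<^sub>2 \<phi> ks ls =
     map_option (mut_map \<nu> B\<^sub>2 ls) \<circ> \<phi> \<circ> inv_into (zero_ext B\<^sub>1) (map_option (mut_map \<nu> B\<^sub>1 ks))"

text \<open>For an admissible map, a nonzero value in the recursion always lies in the mutated set
  of exchangeable elements, so a case distinction on being zero suffices.\<close>

primrec ind_seq ::
  "('a set \<Rightarrow> 'a \<Rightarrow> 'a) \<Rightarrow> 'a set \<Rightarrow> 'a set \<Rightarrow> ('a option \<Rightarrow> 'a option) \<Rightarrow> 'a list \<Rightarrow> 'a list" where
  "ind_seq \<nu> B\<^sub>1 B\<^sub>2 \<phi> [] = []"
| "ind_seq \<nu> B\<^sub>1 B\<^sub>2 \<phi> (k # ks) =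
     (case transport \<nu> B\<^sub>1 B\<^sub>2 \<phi> ks (ind_seq \<nu> B\<^sub>1 B\<^sub>2 \<phi> ks) (Some k) of
        None \<Rightarrow> ind_seq \<nu> B\<^sub>1 B\<^sub>2 \<phi> ks
      | Some l \<Rightarrow> l # ind_seq \<nu> B\<^sub>1 B\<^sub>2 \<phi> ks)"

definition ind_map ::
  "('a set \<Rightarrow> 'a \<Rightarrow> 'a) \<Rightarrow> 'a set \<Rightarrow> 'a set \<Rightarrow> ('a option \<Rightarrow> 'a option) \<Rightarrow>
    'a list \<Rightarrow> 'a option \<Rightarrow> 'a option" where
  "ind_map \<nu> B\<^sub>1 B\<^sub>2 \<phi> ks = transport \<nu> B\<^sub>1 B\<^sub>2 \<phi> ks (ind_seq \<nu> B\<^sub>1 B\<^sub>2 \<phi> ks)"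

definition ind_functor where
  "ind_functor \<nu> ex\<^sub>1 B\<^sub>1 ex\<^sub>2 B\<^sub>2 \<phi> =
     path_functor (exchange_tree \<nu> ex\<^sub>1 B\<^sub>1) (exchange_cat \<nu> ex\<^sub>2 B\<^sub>2)
       (ind_seq \<nu> B\<^sub>1 B\<^sub>2 \<phi>)
       (\<lambda>(ks, k). let ls = ind_seq \<nu> B\<^sub>1 B\<^sub>2 \<phi> ks in
          case ind_map \<nu> B\<^sub>1 B\<^sub>2 \<phi> ks (Some k) of
            None \<Rightarrow> Idt (exchange_cat \<nu> ex\<^sub>2 B\<^sub>2) ls
          | Some l \<Rightarrow> (ls, [(ls, l)], l # ls))"

definition ind_component ::
  "('a set \<Rightarrow> 'a \<Rightarrow> 'a) \<Rightarrow> 'a set \<Rightarrow> 'a set \<Rightarrow> ('a option \<Rightarrow> 'a option) \<Rightarrow>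
    'a list \<Rightarrow> 'a option set \<times> ('a option \<Rightarrow> 'a option) \<times> 'a option set" where
  "ind_component \<nu> B\<^sub>1 B\<^sub>2 \<phi> ks =
     (zero_ext (mut_set \<nu> B\<^sub>1 ks),
      restrict (ind_map \<nu> B\<^sub>1 B\<^sub>2 \<phi> ks) (zero_ext (mut_set \<nu> B\<^sub>1 ks)),
      zero_ext (mut_set \<nu> B\<^sub>2 (ind_seq \<nu> B\<^sub>1 B\<^sub>2 \<phi> ks)))"

end

theory Submission
  imports Defs
begin

text \<open>
  Every component is the conjugate \<open>\<mu>\<^sub>F\<^sub>k \<circ> \<phi> \<circ> \<mu>\<^sub>k\<inverse>\<close> of the one map \<open>\<phi>\<close> by mutation bijections. The bijections
  on the source compose along the arcs, and those on the target compose along the images of the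
  arcs, so each naturality square over an arc commutes by cancellation; a square over an arc that
  \<open>F\<close> contracts leaves the target bijection unchanged. Since the exchange category is free on the
  arcs, this suffices. The conjugates respect the exchangeable elements because these are the
  images of the original ones under the mutation bijections.
\<close>

section \<open>Path categories\<close>

lemma cat_functor_comp:
  assumes "cat_functor C D F" and "cat_functor D E G"
  shows "cat_functor C E (functor_comp G F)"
proof -
  interpret F: cat_functor C D F by fact
  interpret G: cat_functor D E G by fact
  show ?thesis
    by unfold_locales
      (auto simp: functor_comp_def F.FObj_Obj G.FObj_Obj F.FArr_Idt G.FArr_Idt
        intro: G.FArr_Hom F.FArr_Hom, metis F.FArr_Cmp F.FArr_Hom G.FArr_Cmp)
qed

lemma (in pre_digraph) cas_append:
  "cas u p v \<Longrightarrow> cas v q w \<Longrightarrow> cas u (p @ q) w"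
  by (induction p arbitrary: u) auto

lemma Hom_path_cat:
  "f \<in> Hom (path_cat G) u v \<longleftrightarrow> (\<exists>p. f = (u, p, v) \<and> pre_digraph.awalk G u p v)"
  by (auto simp: Hom_def path_cat_def)

lemma path_cat_simps:
  "Obj (path_cat G) = verts G"
  "(u, p, v) \<in> Arr (path_cat G) \<longleftrightarrow> pre_digraph.awalk G u p v"
  "Src (path_cat G) (u, p, v) = u"
  "Tgt (path_cat G) (u, p, v) = v"
  "Idt (path_cat G) u = (u, [], u)"
  "Cmp (path_cat G) (v', q, w) (u, p, v) = (u, p @ q, w)"
  by (simp_all add: path_cat_def)

lemma (in wf_digraph) arc_Hom_path_cat:
  "e \<in> arcs G \<Longrightarrow> (tail G e, [e], head G e) \<in> Hom (path_cat G) (tail G e) (head G e)"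
  by (simp add: Hom_path_cat awalk_def)

lemma (in wf_digraph) category_path_cat: "category (path_cat G)"
proof unfold_locales
  fix f u v w g
  assume "f \<in> Hom (path_cat G) u v" "g \<in> Hom (path_cat G) v w"
  then show "Cmp (path_cat G) g f \<in> Hom (path_cat G) u w"
    by (auto simp: Hom_path_cat path_cat_simps awalk_def intro: cas_append)
qed (auto simp: Hom_path_cat path_cat_simps awalk_Nil_iff
    dest: awalk_hd_in_verts awalk_last_in_verts)

text \<open>The arcs generate the path category, so a property of morphisms needs checking only on
  identities and on extension by an arc. The arc is split off at the start of the walk, as in the
  recursion of \<open>path_value\<close>, so the source vertex varies in \<open>P\<close>.\<close>

lemma (in wf_digraph) path_cat_induct [consumes 1, case_names Idt Cmp]:
  assumes "f \<in> Hom (path_cat G) u v"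
    and "\<And>u. u \<in> verts G \<Longrightarrow> P u (Idt (path_cat G) u) u"
    and "\<And>e g v. e \<in> arcs G \<Longrightarrow> g \<in> Hom (path_cat G) (head G e) v \<Longrightarrow> P (head G e) g v \<Longrightarrow>
      P (tail G e) (Cmp (path_cat G) g (tail G e, [e], head G e)) v"
  shows "P u f v"
proof -
  from assms(1) obtain p where f: "f = (u, p, v)" and p: "awalk u p v"
    by (auto simp: Hom_path_cat)
  from p have "P u (u, p, v) v"
  proof (induction p arbitrary: u)
    case Nil
    then show ?case using assms(2)[of u] by (auto simp: path_cat_simps awalk_Nil_iff)
  next
    case (Cons e p)
    then have "e \<in> arcs G" "u = tail G e" and p: "awalk (head G e) p v"
      by (auto simp: awalk_def)
    then show ?case
      using assms(3)[of e "(head G e, p, v)" v] Cons.IH[OF p]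
      by (simp add: Hom_path_cat path_cat_simps)
  qed
  with f show ?thesis by simp
qed

text \<open>On a one-arc walk the recursion of \<open>path_value\<close> gives \<open>fa e\<close>
  followed by the identity at its end. The left unit law removes that identity, and this law asks
  for \<open>fa e\<close> to end at \<open>fo v\<close>.\<close>

lemma FArr_path_functor_arc:
  assumes "category D" and "head G e = v" and "fa e \<in> Hom D x (fo v)"
  shows "FArr (path_functor G D fo fa) (u, [e], v) = fa e"
  using category.Idt_Cmp[OF assms(1,3)] by (simp add: path_functor_def assms(2))

section \<open>Freeness of the path category on its arcs\<close>

context wf_digraph
begin

text \<open>This is the existence half of the universal property of the free category: vertex and
  arc values with matching endpoints always extend to a functor.\<close>

lemma cat_functor_path_functor:
  assumes "category D"
    and fo: "\<And>u. u \<in> verts G \<Longrightarrow> fo u \<in> Obj D"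
    and fa: "\<And>e. e \<in> arcs G \<Longrightarrow> fa e \<in> Hom D (fo (tail G e)) (fo (head G e))"
  shows "cat_functor (path_cat G) D (path_functor G D fo fa)"
proof -
  interpret P: category "path_cat G" by (rule category_path_cat)
  interpret D: category D by fact
  \<comment> \<open>Typing comes first, because the unit and associativity laws of \<open>D\<close>
    are given only for morphisms in matching \<open>Hom\<close> sets.\<close>
  have val: "path_value G D fo fa u p \<in> Hom D (fo u) (fo v)" if "awalk u p v" for u p v
    using that
  proof (induction p arbitrary: u)
    case Nil
    then show ?case by (auto simp: awalk_Nil_iff intro: D.Idt_Hom fo)
  next
    case (Cons e p)
    then have "e \<in> arcs G" "u = tail G e" "awalk (head G e) p v"
      by (auto simp: awalk_def)
    with Cons.IH[of "head G e"] fa[of e] show ?case by (auto intro: D.Cmp_Hom)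
  qed
  \<comment> \<open>Concatenation of walks becomes composition. The induction is on the walk
    traversed first: the right unit law handles the empty walk and associativity the extension by an
    arc.\<close>
  have app: "path_value G D fo fa u (p @ q) =
      Cmp D (path_value G D fo fa v q) (path_value G D fo fa u p)"
    if "awalk u p v" "awalk v q w" for u p v q w
    using that
  proof (induction p arbitrary: u)
    case Nil
    then show ?case using D.Cmp_Idt[OF val[OF Nil(2)]] by (simp add: awalk_Nil_iff)
  next
    case (Cons e p)
    then have e: "e \<in> arcs G" "u = tail G e" and p: "awalk (head G e) p v"
      by (auto simp: awalk_def)
    with Cons.IH[OF p] Cons.prems fa[OF e(1)] val[OF p] val[OF Cons.prems(2)]
    show ?case by (simp add: D.Cmp_assoc)
  qed
  show ?thesis
    by unfold_locales
      (auto simp: Hom_path_cat path_cat_simps path_functor_def fo val app)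
qed

text \<open>Naturality squares paste. If the squares over an arc and over the remaining walk
  commute, so does the square over their composite, and the square over an identity is
  trivial.\<close>

lemma natural_transformation_path_catI:
  assumes F: "cat_functor (path_cat G) D F" and H: "cat_functor (path_cat G) D H"
    and comp: "\<And>u. u \<in> verts G \<Longrightarrow> \<eta> u \<in> Hom D (FObj F u) (FObj H u)"
    and nat: "\<And>e. e \<in> arcs G \<Longrightarrow>
      Cmp D (\<eta> (head G e)) (FArr F (tail G e, [e], head G e)) =
      Cmp D (FArr H (tail G e, [e], head G e)) (\<eta> (tail G e))"
  shows "natural_transformation (path_cat G) D F H \<eta>"
proof -
  interpret F: cat_functor "path_cat G" D F by fact
  interpret H: cat_functor "path_cat G" D H by fact
  have obj: "Obj (path_cat G) = verts G" by (simp add: path_cat_def)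
  show ?thesis
  proof unfold_locales
    fix f u v
    assume "f \<in> Hom (path_cat G) u v"
    then show "Cmp D (\<eta> v) (FArr F f) = Cmp D (FArr H f) (\<eta> u)"
    proof (induction rule: path_cat_induct)
      case (Idt u)
      with comp[OF Idt] show ?case
        by (simp add: F.FArr_Idt H.FArr_Idt obj F.cod_cat.Cmp_Idt F.cod_cat.Idt_Cmp)
    next
      case (Cmp e g v)
      let ?e = "(tail G e, [e], head G e)"
      note e = arc_Hom_path_cat[OF Cmp(1)]
      have v: "v \<in> verts G" using Cmp(2) awalk_last_in_verts by (auto simp: Hom_path_cat)
      note Fe = F.FArr_Hom[OF e] and He = H.FArr_Hom[OF e]
      note Fg = F.FArr_Hom[OF Cmp(2)] and Hg = H.FArr_Hom[OF Cmp(2)]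
      \<comment> \<open>The component moves from the right end to the left end: past
        \<open>g\<close> by the induction hypothesis, then past the arc by \<open>nat\<close>, with
        reassociation in between.\<close>
      have "Cmp D (\<eta> v) (FArr F (Cmp (path_cat G) g ?e)) =
          Cmp D (Cmp D (\<eta> v) (FArr F g)) (FArr F ?e)"
        using F.cod_cat.Cmp_assoc[OF Fe Fg comp[OF v]] by (simp add: F.FArr_Cmp[OF e Cmp(2)])
      also have "\<dots> = Cmp D (FArr H g) (Cmp D (\<eta> (head G e)) (FArr F ?e))"
        using F.cod_cat.Cmp_assoc[OF Fe comp Hg] Cmp(1,3) by simp
      also have "\<dots> = Cmp D (FArr H (Cmp (path_cat G) g ?e)) (\<eta> (tail G e))"
        using F.cod_cat.Cmp_assoc[OF comp He Hg] Cmp(1)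
        by (simp add: H.FArr_Cmp[OF e Cmp(2)] nat)
      finally show ?case .
    qed
  qed (use comp in \<open>simp add: obj\<close>)
qed

end

section \<open>The category of sets\<close>

lemma Hom_set_cat: "f \<in> Hom set_cat A B \<longleftrightarrow> (\<exists>h. f = (A, h, B) \<and> h \<in> A \<rightarrow>\<^sub>E B)"
  by (auto simp: Hom_def set_cat_def)

lemma set_cat_simps:
  "Obj set_cat = UNIV"
  "(A, f, B) \<in> Arr set_cat \<longleftrightarrow> f \<in> A \<rightarrow>\<^sub>E B"
  "Src set_cat (A, f, B) = A"
  "Tgt set_cat (A, f, B) = B"
  "Idt set_cat A = (A, (\<lambda>x\<in>A. x), A)"
  "Cmp set_cat (B', g, C) (A, f, B) = (A, compose A g f, C)"
  by (simp_all add: set_cat_def)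

lemma category_set_cat: "category set_cat"
proof unfold_locales
  fix f g :: "'a set \<times> ('a \<Rightarrow> 'a) \<times> 'a set" and A B C
  assume "f \<in> Hom set_cat A B" "g \<in> Hom set_cat B C"
  then show "Cmp set_cat g f \<in> Hom set_cat A C"
    by (auto simp: Hom_set_cat set_cat_simps PiE_def Pi_iff compose_eq)
qed (auto simp: Hom_set_cat set_cat_simps PiE_def Id_compose compose_Id intro: compose_assoc)

text \<open>Since \<open>f\<close> lands in \<open>B\<close>, restricting \<open>g\<close> to
  \<open>B\<close> is invisible after \<open>f\<close>. Equations between morphisms of sets thus
  reduce to pointwise equations between total functions.\<close>

lemma Cmp_set_cat_restrict:
  "f \<in> A \<rightarrow> B \<Longrightarrow>
    Cmp set_cat (B, restrict g B, C) (A, restrict f A, B) = (A, restrict (g \<circ> f) A, C)"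
  by (auto simp: set_cat_simps compose_def fun_eq_iff)

section \<open>Mutation bijections\<close>

lemma zero_ext_simps [simp]:
  "None \<in> zero_ext S" "Some x \<in> zero_ext S \<longleftrightarrow> x \<in> S"
  by (auto simp: zero_ext_def)

lemma zero_ext_image: "zero_ext (f ` S) = map_option f ` zero_ext S"
  by (auto simp: zero_ext_def image_image)

lemma map_option_zero_ext:
  "f \<in> A \<rightarrow> B \<Longrightarrow> map_option f \<in> zero_ext A \<rightarrow> zero_ext B"
  by (auto simp: zero_ext_def)

text \<open>Membership of \<open>k\<close> matters: otherwise the left side would still receive the
  replacement, while the step would fix every element of the set.\<close>

lemma mut_set_Cons:
  "k \<in> mut_set \<nu> B ks \<Longrightarrow>
    mut_set \<nu> B (k # ks) = mut_step \<nu> (mut_set \<nu> B ks) k ` mut_set \<nu> B ks"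
  by (auto simp: mut_step_def)

lemma mut_ex_Cons:
  "k \<in> mut_ex \<nu> ex B ks \<Longrightarrow>
    mut_ex \<nu> ex B (k # ks) = mut_step \<nu> (mut_set \<nu> B ks) k ` mut_ex \<nu> ex B ks"
  by (auto simp: mut_step_def)

text \<open>Both sets lose \<open>k\<close> and gain the same replacement, which is chosen relative
  to the larger set in either recursion.\<close>

lemma mut_ex_subset: "ex \<subseteq> B \<Longrightarrow> mut_ex \<nu> ex B ks \<subseteq> mut_set \<nu> B ks"
  by (induction ks) auto

lemma mut_set_eq_image:
  "ks \<in> adm_seqs \<nu> ex B \<Longrightarrow> ex \<subseteq> B \<Longrightarrow> mut_set \<nu> B ks = mut_map \<nu> B ks ` B"
proof (induction rule: adm_seqs.induct)
  case (Cons ks k)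
  then have "k \<in> mut_set \<nu> B ks" using mut_ex_subset by blast
  with Cons show ?case
    by (simp only: mut_set_Cons mut_map.simps image_comp)
qed simp

lemma mut_ex_eq_image:
  "ks \<in> adm_seqs \<nu> ex B \<Longrightarrow> mut_ex \<nu> ex B ks = mut_map \<nu> B ks ` ex"
proof (induction rule: adm_seqs.induct)
  case (Cons ks k)
  then show ?case by (simp only: mut_ex_Cons mut_map.simps image_comp)
qed simp

text \<open>Newness enters here: a step moves only \<open>k\<close>, and it moves \<open>k\<close>
  outside the current set, so it cannot collide with a fixed element. The current set is the image
  of \<open>B\<close> under the earlier steps, hence the composite is injective on
  \<open>B\<close>.\<close>

lemma inj_on_mut_map:
  assumes "ks \<in> adm_seqs \<nu> ex B" and "ex \<subseteq> B" and "new_elements \<nu> ex B"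
  shows "inj_on (mut_map \<nu> B ks) B"
  using assms(1)
proof (induction rule: adm_seqs.induct)
  case (Cons ks k)
  then have "\<nu> (mut_set \<nu> B ks) k \<notin> mut_set \<nu> B ks"
    using assms(3) by (auto simp: new_elements_def)
  then have "inj_on (mut_step \<nu> (mut_set \<nu> B ks) k) (mut_set \<nu> B ks)"
    by (auto simp: inj_on_def mut_step_def)
  then show ?case
    using comp_inj_on[OF Cons.IH] mut_set_eq_image[OF Cons.hyps(1) assms(2)]
    by (simp only: mut_map.simps)
qed simp

section \<open>The exchange tree and the mutation functor\<close>

lemma wf_digraph_exchange_tree: "wf_digraph (exchange_tree \<nu> ex B)"
  by unfold_locales (auto simp: exchange_tree_def intro: adm_seqs.Cons)

lemma mut_functor_arc_Hom:
  fixes \<nu> :: "'a set \<Rightarrow> 'a \<Rightarrow> 'a"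
  assumes "ex \<subseteq> B" and "k \<in> mut_ex \<nu> ex B ks"
  shows "(zero_ext (mut_set \<nu> B ks),
      restrict (map_option (mut_step \<nu> (mut_set \<nu> B ks) k)) (zero_ext (mut_set \<nu> B ks)),
      zero_ext (mut_set \<nu> B (k # ks)))
    \<in> Hom set_cat (zero_ext (mut_set \<nu> B ks)) (zero_ext (mut_set \<nu> B (k # ks)))"
proof -
  have "k \<in> mut_set \<nu> B ks" using assms mut_ex_subset by blast
  then have "mut_step \<nu> (mut_set \<nu> B ks) k \<in> mut_set \<nu> B ks \<rightarrow> mut_set \<nu> B (k # ks)"
    by (simp add: mut_set_Cons del: mut_set.simps)
  from map_option_zero_ext[OF this] show ?thesis by (simp add: Hom_set_cat)
qed

lemma cat_functor_mut_functor:
  fixes \<nu> :: "'a set \<Rightarrow> 'a \<Rightarrow> 'a"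
  assumes "ex \<subseteq> B"
  shows "cat_functor (exchange_cat \<nu> ex B) set_cat (mut_functor \<nu> ex B)"
  unfolding mut_functor_def
  by (rule wf_digraph.cat_functor_path_functor[OF wf_digraph_exchange_tree category_set_cat])
    (auto simp: exchange_tree_def set_cat_simps mut_functor_arc_Hom[OF assms]
      simp del: mut_set.simps)

lemma FArr_mut_functor:
  fixes \<nu> :: "'a set \<Rightarrow> 'a \<Rightarrow> 'a"
  assumes "ex \<subseteq> B" and "k \<in> mut_ex \<nu> ex B ks"
  shows "FArr (mut_functor \<nu> ex B) (ks, [(ks, k)], k # ks) = (zero_ext (mut_set \<nu> B ks),
      restrict (map_option (mut_step \<nu> (mut_set \<nu> B ks) k)) (zero_ext (mut_set \<nu> B ks)),
      zero_ext (mut_set \<nu> B (k # ks)))"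
  unfolding mut_functor_def
  by (subst FArr_path_functor_arc[OF category_set_cat,
        where x = "zero_ext (mut_set \<nu> B ks)"])
    (simp_all add: exchange_tree_def mut_functor_arc_Hom[OF assms] del: mut_set.simps)

lemma FObj_mut_functor: "FObj (mut_functor \<nu> ex B) ks = zero_ext (mut_set \<nu> B ks)"
  by (simp add: mut_functor_def path_functor_def)

section \<open>Induced maps\<close>

locale admissible_map =
  fixes \<nu> :: "'a set \<Rightarrow> 'a \<Rightarrow> 'a"
    and ex\<^sub>1 B\<^sub>1 ex\<^sub>2 B\<^sub>2 :: "'a set"
    and \<phi> :: "'a option \<Rightarrow> 'a option"
  assumes ex_sub: "ex\<^sub>1 \<subseteq> B\<^sub>1" "ex\<^sub>2 \<subseteq> B\<^sub>2"
    and new1: "new_elements \<nu> ex\<^sub>1 B\<^sub>1"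
    and adm: "ex_admissible ex\<^sub>1 B\<^sub>1 ex\<^sub>2 B\<^sub>2 \<phi>"
begin

abbreviation "F \<equiv> ind_seq \<nu> B\<^sub>1 B\<^sub>2 \<phi>"
abbreviation "\<phi>' \<equiv> ind_map \<nu> B\<^sub>1 B\<^sub>2 \<phi>"
abbreviation "K\<^sub>1 \<equiv> adm_seqs \<nu> ex\<^sub>1 B\<^sub>1"
abbreviation "K\<^sub>2 \<equiv> adm_seqs \<nu> ex\<^sub>2 B\<^sub>2"

lemma phi_zero: "\<phi> None = None"
  and phi_B: "x \<in> zero_ext B\<^sub>1 \<Longrightarrow> \<phi> x \<in> zero_ext B\<^sub>2"
  and phi_ex: "x \<in> zero_ext ex\<^sub>1 \<Longrightarrow> \<phi> x \<in> zero_ext ex\<^sub>2"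
  using adm by (auto simp: ex_admissible_def zero_ext_def image_subset_iff)

lemma zero_ext_mut_set:
  "ks \<in> K\<^sub>1 \<Longrightarrow> zero_ext (mut_set \<nu> B\<^sub>1 ks) = map_option (mut_map \<nu> B\<^sub>1 ks) ` zero_ext B\<^sub>1"
  by (simp add: mut_set_eq_image[OF _ ex_sub(1)] zero_ext_image)

text \<open>Injectivity lets \<open>inv_into\<close> cancel the source bijection. Every later
  computation with \<open>\<phi>'\<close> writes its argument as the image of a point of
  \<open>zero_ext B\<^sub>1\<close> and applies this equation, so the inverse never
  reappears.\<close>

lemma ind_map_mut_map:
  assumes "ks \<in> K\<^sub>1" and "x \<in> zero_ext B\<^sub>1"
  shows "\<phi>' ks (map_option (mut_map \<nu> B\<^sub>1 ks) x) = map_option (mut_map \<nu> B\<^sub>2 (F ks)) (\<phi> x)"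
proof -
  \<comment> \<open>Adjoining zero keeps injectivity, as \<open>map_option\<close> sends only
    \<open>None\<close> to \<open>None\<close>.\<close>
  have "inj_on (map_option (mut_map \<nu> B\<^sub>1 ks)) (zero_ext B\<^sub>1)"
    using inj_on_mut_map[OF assms(1) ex_sub(1) new1]
    by (auto simp: inj_on_def zero_ext_def)
  then show ?thesis using assms(2) by (simp add: ind_map_def transport_def)
qed

text \<open>A point is pulled back to \<open>ex\<^sub>1\<close>, where admissibility of \<phi>
  applies, and the value is pushed forward along \<open>F ks\<close>. Admissibility of
  \<open>F ks\<close> is a hypothesis because the lemma drives the induction that establishes
  it.\<close>

lemma ind_map_mut_ex:
  assumes "ks \<in> K\<^sub>1" and "F ks \<in> K\<^sub>2" and "x \<in> zero_ext (mut_ex \<nu> ex\<^sub>1 B\<^sub>1 ks)"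
  shows "\<phi>' ks x \<in> zero_ext (mut_ex \<nu> ex\<^sub>2 B\<^sub>2 (F ks))"
proof -
  obtain y where y: "y \<in> zero_ext ex\<^sub>1" "x = map_option (mut_map \<nu> B\<^sub>1 ks) y"
    using assms(1,3) by (auto simp: mut_ex_eq_image zero_ext_image)
  then have "y \<in> zero_ext B\<^sub>1" using ex_sub(1) by (auto simp: zero_ext_def)
  with y assms(1,2) show ?thesis
    by (simp add: ind_map_mut_map mut_ex_eq_image zero_ext_image phi_ex)
qed

text \<open>The recursion is stated through \<open>transport\<close>, since \<open>ind_map\<close>
  itself depends on \<open>ind_seq\<close>. This form recovers the recursion through the induced
  map.\<close>

lemma ind_seq_Cons:
  "F (k # ks) = (case \<phi>' ks (Some k) of None \<Rightarrow> F ks | Some l \<Rightarrow> l # F ks)"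
  by (simp add: ind_map_def)

lemma ind_seq_adm: "ks \<in> K\<^sub>1 \<Longrightarrow> F ks \<in> K\<^sub>2"
proof (induction rule: adm_seqs.induct)
  case (Cons ks k)
  then show ?case
    using ind_map_mut_ex[of ks "Some k"]
    by (auto simp: ind_seq_Cons simp del: ind_seq.simps split: option.split intro: adm_seqs.Cons)
qed (simp add: adm_seqs.Nil)

text \<open>This justifies testing only for zero in the recursion: a nonzero value always labels an
  arc leaving \<open>F ks\<close> in the second tree.\<close>

lemma ind_map_nonzero:
  "ks \<in> K\<^sub>1 \<Longrightarrow> k \<in> mut_ex \<nu> ex\<^sub>1 B\<^sub>1 ks \<Longrightarrow> \<phi>' ks (Some k) = Some l \<Longrightarrow>
    l \<in> mut_ex \<nu> ex\<^sub>2 B\<^sub>2 (F ks)"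
  using ind_map_mut_ex[of ks "Some k"] ind_seq_adm by simp

lemma ind_map_funcset:
  assumes "ks \<in> K\<^sub>1"
  shows "\<phi>' ks \<in> zero_ext (mut_set \<nu> B\<^sub>1 ks) \<rightarrow> zero_ext (mut_set \<nu> B\<^sub>2 (F ks))"
  using assms ind_seq_adm[OF assms]
  by (auto simp: zero_ext_mut_set ind_map_mut_map phi_B zero_ext_image
      mut_set_eq_image[OF _ ex_sub(2)])

text \<open>This is the naturality square over one arc, on elements. With \<open>x\<close> the image
  of \<open>y\<close>, both sides are mutation images of \<open>\<phi> y\<close>: along
  \<open>F ks\<close> if the arc is contracted, and along \<open>l # F ks\<close> otherwise.\<close>

lemma ind_map_square:
  assumes ks: "ks \<in> K\<^sub>1" and k: "k \<in> mut_ex \<nu> ex\<^sub>1 B\<^sub>1 ks"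
    and x: "x \<in> zero_ext (mut_set \<nu> B\<^sub>1 ks)"
  shows "\<phi>' (k # ks) (map_option (mut_step \<nu> (mut_set \<nu> B\<^sub>1 ks) k) x) =
    (case \<phi>' ks (Some k) of
       None \<Rightarrow> \<phi>' ks x
     | Some l \<Rightarrow> map_option (mut_step \<nu> (mut_set \<nu> B\<^sub>2 (F ks)) l) (\<phi>' ks x))"
proof -
  obtain y where y: "y \<in> zero_ext B\<^sub>1" and xy: "x = map_option (mut_map \<nu> B\<^sub>1 ks) y"
    using x by (auto simp: zero_ext_mut_set[OF ks])
  have "map_option (mut_step \<nu> (mut_set \<nu> B\<^sub>1 ks) k) x = map_option (mut_map \<nu> B\<^sub>1 (k # ks)) y"
    by (simp add: xy option.map_comp)
  then have "\<phi>' (k # ks) (map_option (mut_step \<nu> (mut_set \<nu> B\<^sub>1 ks) k) x) =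
      map_option (mut_map \<nu> B\<^sub>2 (F (k # ks))) (\<phi> y)"
    by (simp only: ind_map_mut_map[OF adm_seqs.Cons[OF ks k] y])
  also have "\<dots> = (case \<phi>' ks (Some k) of
       None \<Rightarrow> \<phi>' ks x
     | Some l \<Rightarrow> map_option (mut_step \<nu> (mut_set \<nu> B\<^sub>2 (F ks)) l) (\<phi>' ks x))"
    unfolding ind_seq_Cons xy ind_map_mut_map[OF ks y]
    by (simp add: option.map_comp split: option.split)
  finally show ?thesis .
qed

section \<open>The functor between the exchange categories\<close>

lemma ind_functor_arc_Hom:
  assumes ks: "ks \<in> K\<^sub>1" and k: "k \<in> mut_ex \<nu> ex\<^sub>1 B\<^sub>1 ks"
  shows "(case \<phi>' ks (Some k) of
      None \<Rightarrow> Idt (exchange_cat \<nu> ex\<^sub>2 B\<^sub>2) (F ks)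
    | Some l \<Rightarrow> (F ks, [(F ks, l)], l # F ks)) \<in> Hom (exchange_cat \<nu> ex\<^sub>2 B\<^sub>2) (F ks) (F (k # ks))"
proof (cases "\<phi>' ks (Some k)")
  \<comment> \<open>Here \<open>F (k # ks) = F ks\<close>, so the identity has the required
    target.\<close>
  case None
  then show ?thesis
    using category.Idt_Hom[OF wf_digraph.category_path_cat[OF wf_digraph_exchange_tree]]
      ind_seq_adm[OF ks]
    by (simp add: ind_seq_Cons path_cat_def exchange_tree_def del: ind_seq.simps)
next
  case (Some l)
  then show ?thesis
    using wf_digraph.arc_Hom_path_cat[OF wf_digraph_exchange_tree[of \<nu> ex\<^sub>2 B\<^sub>2],
        where e = "(F ks, l)"] ind_map_nonzero[OF ks k Some] ind_seq_adm[OF ks]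
    by (simp add: ind_seq_Cons exchange_tree_def del: ind_seq.simps)
qed

lemma cat_functor_ind_functor:
  "cat_functor (exchange_cat \<nu> ex\<^sub>1 B\<^sub>1) (exchange_cat \<nu> ex\<^sub>2 B\<^sub>2) (ind_functor \<nu> ex\<^sub>1 B\<^sub>1 ex\<^sub>2 B\<^sub>2 \<phi>)"
  unfolding ind_functor_def Let_def
proof (rule wf_digraph.cat_functor_path_functor[OF wf_digraph_exchange_tree
      wf_digraph.category_path_cat[OF wf_digraph_exchange_tree]])
  fix ks assume "ks \<in> verts (exchange_tree \<nu> ex\<^sub>1 B\<^sub>1)"
  then show "F ks \<in> Obj (exchange_cat \<nu> ex\<^sub>2 B\<^sub>2)"
    using ind_seq_adm by (simp add: path_cat_simps exchange_tree_def)
next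
  fix e assume "e \<in> arcs (exchange_tree \<nu> ex\<^sub>1 B\<^sub>1)"
  then obtain ks k where e: "e = (ks, k)" and "ks \<in> K\<^sub>1" "k \<in> mut_ex \<nu> ex\<^sub>1 B\<^sub>1 ks"
    by (auto simp: exchange_tree_def)
  moreover have "tail (exchange_tree \<nu> ex\<^sub>1 B\<^sub>1) e = ks" "head (exchange_tree \<nu> ex\<^sub>1 B\<^sub>1) e = k # ks"
    by (simp_all add: e exchange_tree_def)
  ultimately show "(case e of (ks, k) \<Rightarrow>
      case \<phi>' ks (Some k) of
        None \<Rightarrow> Idt (exchange_cat \<nu> ex\<^sub>2 B\<^sub>2) (F ks)
      | Some l \<Rightarrow> (F ks, [(F ks, l)], l # F ks))
      \<in> Hom (exchange_cat \<nu> ex\<^sub>2 B\<^sub>2) (F (tail (exchange_tree \<nu> ex\<^sub>1 B\<^sub>1) e))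
          (F (head (exchange_tree \<nu> ex\<^sub>1 B\<^sub>1) e))"
    using ind_functor_arc_Hom by (simp del: ind_seq.simps)
qed

lemma FObj_ind_functor: "FObj (ind_functor \<nu> ex\<^sub>1 B\<^sub>1 ex\<^sub>2 B\<^sub>2 \<phi>) ks = F ks"
  by (simp add: ind_functor_def path_functor_def)

lemma FArr_ind_functor:
  assumes "ks \<in> K\<^sub>1" and "k \<in> mut_ex \<nu> ex\<^sub>1 B\<^sub>1 ks"
  shows "FArr (ind_functor \<nu> ex\<^sub>1 B\<^sub>1 ex\<^sub>2 B\<^sub>2 \<phi>) (ks, [(ks, k)], k # ks) =
    (case \<phi>' ks (Some k) of
       None \<Rightarrow> Idt (exchange_cat \<nu> ex\<^sub>2 B\<^sub>2) (F ks)
     | Some l \<Rightarrow> (F ks, [(F ks, l)], l # F ks))"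
  unfolding ind_functor_def Let_def
proof (subst FArr_path_functor_arc[OF
      wf_digraph.category_path_cat[OF wf_digraph_exchange_tree[of \<nu> ex\<^sub>2 B\<^sub>2]],
      where x = "F ks"])
  show "head (exchange_tree \<nu> ex\<^sub>1 B\<^sub>1) (ks, k) = k # ks"
    by (simp add: exchange_tree_def)
qed (simp_all only: prod.case ind_functor_arc_Hom[OF assms])

text \<open>Contracted and uncontracted arcs both take the form of one restricted function, with
  \<open>id\<close> for the contracted ones, so that \<open>Cmp_set_cat_restrict\<close> applies to
  either.\<close>

lemma FArr_comp:
  assumes ks: "ks \<in> K\<^sub>1" and k: "k \<in> mut_ex \<nu> ex\<^sub>1 B\<^sub>1 ks"
  shows "FArr (functor_comp (mut_functor \<nu> ex\<^sub>2 B\<^sub>2) (ind_functor \<nu> ex\<^sub>1 B\<^sub>1 ex\<^sub>2 B\<^sub>2 \<phi>))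
      (ks, [(ks, k)], k # ks) =
    (zero_ext (mut_set \<nu> B\<^sub>2 (F ks)),
     restrict (case \<phi>' ks (Some k) of
         None \<Rightarrow> id
       | Some l \<Rightarrow> map_option (mut_step \<nu> (mut_set \<nu> B\<^sub>2 (F ks)) l)) (zero_ext (mut_set \<nu> B\<^sub>2 (F ks))),
     zero_ext (mut_set \<nu> B\<^sub>2 (F (k # ks))))"
proof (cases "\<phi>' ks (Some k)")
  case None
  have "F ks \<in> Obj (exchange_cat \<nu> ex\<^sub>2 B\<^sub>2)"
    using ind_seq_adm[OF ks] by (simp add: path_cat_simps exchange_tree_def)
  from None cat_functor.FArr_Idt[OF cat_functor_mut_functor[OF ex_sub(2)] this]
  show ?thesis
    by (simp add: functor_comp_def FArr_ind_functor[OF ks k] FObj_mut_functor ind_seq_Cons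
        del: ind_seq.simps) (simp add: set_cat_simps id_def)
next
  case (Some l)
  then show ?thesis
    using FArr_mut_functor[OF ex_sub(2) ind_map_nonzero[OF ks k Some]]
    by (simp add: functor_comp_def FArr_ind_functor[OF ks k] ind_seq_Cons
        del: ind_seq.simps mut_set.simps)
qed

section \<open>Naturality of the conjugated maps\<close>

lemma natural_transformation_ind_component:
  "natural_transformation (exchange_cat \<nu> ex\<^sub>1 B\<^sub>1) set_cat
    (mut_functor \<nu> ex\<^sub>1 B\<^sub>1)
    (functor_comp (mut_functor \<nu> ex\<^sub>2 B\<^sub>2) (ind_functor \<nu> ex\<^sub>1 B\<^sub>1 ex\<^sub>2 B\<^sub>2 \<phi>))
    (ind_component \<nu> B\<^sub>1 B\<^sub>2 \<phi>)"
    (is "natural_transformation ?C _ ?M ?N ?\<eta>")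
proof (rule wf_digraph.natural_transformation_path_catI[OF wf_digraph_exchange_tree])
  show "cat_functor ?C set_cat ?M"
    by (rule cat_functor_mut_functor[OF ex_sub(1)])
  show "cat_functor ?C set_cat ?N"
    by (rule cat_functor_comp[OF cat_functor_ind_functor cat_functor_mut_functor[OF ex_sub(2)]])
next
  fix ks assume "ks \<in> verts (exchange_tree \<nu> ex\<^sub>1 B\<^sub>1)"
  then have "ks \<in> K\<^sub>1" by (simp add: exchange_tree_def)
  then show "?\<eta> ks \<in> Hom set_cat (FObj ?M ks) (FObj ?N ks)"
    using ind_map_funcset
    by (simp add: Hom_set_cat ind_component_def functor_comp_def FObj_mut_functor FObj_ind_functor)
next
  let ?T = "exchange_tree \<nu> ex\<^sub>1 B\<^sub>1"
  fix e assume "e \<in> arcs ?T"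
  then obtain ks k where e: "e = (ks, k)" and ks: "ks \<in> K\<^sub>1" and k: "k \<in> mut_ex \<nu> ex\<^sub>1 B\<^sub>1 ks"
    by (auto simp: exchange_tree_def)
  have ends: "tail ?T e = ks" "head ?T e = k # ks"
    by (simp_all add: e exchange_tree_def)
  let ?Z = "zero_ext (mut_set \<nu> B\<^sub>1 ks)" and ?Z' = "zero_ext (mut_set \<nu> B\<^sub>2 (F (k # ks)))"
  let ?m = "map_option (mut_step \<nu> (mut_set \<nu> B\<^sub>1 ks) k)"
  let ?n = "case \<phi>' ks (Some k) of
      None \<Rightarrow> id | Some l \<Rightarrow> map_option (mut_step \<nu> (mut_set \<nu> B\<^sub>2 (F ks)) l)"
  have m: "?m \<in> ?Z \<rightarrow> zero_ext (mut_set \<nu> B\<^sub>1 (k # ks))"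
    using mut_functor_arc_Hom[OF ex_sub(1) k] by (simp add: Hom_set_cat del: mut_set.simps)
  \<comment> \<open>The two paths around the square, as functions restricted to the source set;
    their equality there is \<open>ind_map_square\<close>.\<close>
  have sq: "restrict (\<phi>' (k # ks) \<circ> ?m) ?Z = restrict (?n \<circ> \<phi>' ks) ?Z"
    by (rule restrict_ext) (simp add: ind_map_square[OF ks k] split: option.split)
  have "Cmp set_cat (?\<eta> (k # ks)) (FArr ?M (ks, [e], k # ks)) =
      (?Z, restrict (\<phi>' (k # ks) \<circ> ?m) ?Z, ?Z')"
    unfolding e FArr_mut_functor[OF ex_sub(1) k] ind_component_def
    by (rule Cmp_set_cat_restrict[OF m])
  also have "\<dots> = Cmp set_cat (FArr ?N (ks, [e], k # ks)) (?\<eta> ks)"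
    unfolding e FArr_comp[OF ks k] ind_component_def sq
    by (rule Cmp_set_cat_restrict[OF ind_map_funcset[OF ks], symmetric])
  finally show "Cmp set_cat (?\<eta> (head ?T e)) (FArr ?M (tail ?T e, [e], head ?T e)) =
      Cmp set_cat (FArr ?N (tail ?T e, [e], head ?T e)) (?\<eta> (tail ?T e))"
    by (simp only: ends)
qed

end

theorem proposition7p10:
  fixes \<nu> :: "'a set \<Rightarrow> 'a \<Rightarrow> 'a"
    and ex\<^sub>1 B\<^sub>1 ex\<^sub>2 B\<^sub>2 :: "'a set"
    and \<phi> :: "'a option \<Rightarrow> 'a option"
  assumes "countable B\<^sub>1" and "countable B\<^sub>2"
    and "ex\<^sub>1 \<subseteq> B\<^sub>1" and "ex\<^sub>2 \<subseteq> B\<^sub>2"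
    and "new_elements \<nu> ex\<^sub>1 B\<^sub>1" and "new_elements \<nu> ex\<^sub>2 B\<^sub>2"
    and "ex_admissible ex\<^sub>1 B\<^sub>1 ex\<^sub>2 B\<^sub>2 \<phi>"
  shows "natural_transformation (exchange_cat \<nu> ex\<^sub>1 B\<^sub>1) set_cat
    (mut_functor \<nu> ex\<^sub>1 B\<^sub>1)
    (functor_comp (mut_functor \<nu> ex\<^sub>2 B\<^sub>2) (ind_functor \<nu> ex\<^sub>1 B\<^sub>1 ex\<^sub>2 B\<^sub>2 \<phi>))
    (ind_component \<nu> B\<^sub>1 B\<^sub>2 \<phi>)"
  using assms by (intro admissible_map.natural_transformation_ind_component admissible_map.intro)

end
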